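(* Let $n\ge2$, let $\Omega$ be a bounded convex domain of $\mathbb{R}^n$ that satisfies the interior ball condition, and let $\gamma\ge1$, $c>0$, $\delta\ge0$. Let $f,g\in C(\overline\Omega,\mathbb{R}^+)$ and let $u\in C(\overline\Omega)\cap C^2(\Omega)$ be a solution to $$\Delta u+f(x)-u^{\frac{1+\gamma}{1+2\gamma}}g(x)=0\ \text{ in }\Omega,\qquad u=0\ \text{ on }\partial\Omega,\qquad u>0\ \text{ in }\Omega.$$ Assume that $f^\gamma$ is concave, that $f(x)\ge c$ in $\Omega$, that, denoting $m:=\|u\|_{L^\infty(\Omega)}$, $$f(x)\ge m^{\frac{1+\gamma}{1+2\gamma}}g(x)\quad\text{in }\Omega,$$ and that $$\mathcal{HC}_g(x_1,x_3,\lambda)\le\delta\quad\text{for all }x_1,x_3\in\Omega,\ \lambda\in[0,1].$$ Then there exist a concave function $v:\Omega\to\mathbb{R}$ and a constant $C=C(n,c,m,\gamma)$ such that $$\|u^{\frac{\gamma}{1+2\gamma}}-v\|_{L^\infty(\Omega)}\le C\delta.$$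
   Context: $\mathbb{R}^+=(0,\infty)$. A domain is a connected open set. For a positive function $g$ on $\overline\Omega$, the harmonic convexity function is $$\mathcal{HC}_g(x_1,x_3,\lambda):=g(\lambda x_1+(1-\lambda)x_3)-\frac{g(x_1)g(x_3)}{(1-\lambda)g(x_1)+\lambda g(x_3)}.$$ The notation $C=C(n,c,m,\gamma)$ means that the constant depends only on these quantities. *)

theory Defs
  imports "HOL-Analysis.Analysis" "HOL-Probability.Essential_Supremum"
begin

definition partial_deriv :: "'n::finite \<Rightarrow> (real ^ 'n \<Rightarrow> real) \<Rightarrow> real ^ 'n \<Rightarrow> real" where
  "partial_deriv i u x = deriv (\<lambda>t::real. u (x + t *\<^sub>R axis i 1)) 0"

text \<open>For open \<open>S\<close>, these are the usual classes of once and twice continuously differentiable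
  functions. Differentiability is required explicitly because \<open>deriv\<close> is total and carries no
  information at points where the derivative fails to exist.\<close>

definition C1_on :: "(real ^ 'n::finite) set \<Rightarrow> (real ^ 'n \<Rightarrow> real) \<Rightarrow> bool" where
  "C1_on S u \<longleftrightarrow>
     (\<forall>x\<in>S. u differentiable (at x)) \<and> (\<forall>i. continuous_on S (partial_deriv i u))"

definition C2_on :: "(real ^ 'n::finite) set \<Rightarrow> (real ^ 'n \<Rightarrow> real) \<Rightarrow> bool" where
  "C2_on S u \<longleftrightarrow> C1_on S u \<and> (\<forall>i. C1_on S (partial_deriv i u))"

definition laplacian :: "(real ^ 'n::finite \<Rightarrow> real) \<Rightarrow> real ^ 'n \<Rightarrow> real" where
  "laplacian u x = (\<Sum>i\<in>UNIV. partial_deriv i (partial_deriv i u) x)"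

text \<open>The radius of the touching ball may depend on the boundary point.\<close>

definition interior_ball_condition :: "(real ^ 'n::finite) set \<Rightarrow> bool" where
  "interior_ball_condition S \<longleftrightarrow>
     (\<forall>x\<in>frontier S. \<exists>y r. r > 0 \<and> ball y r \<subseteq> S \<and> x \<in> sphere y r)"

definition harmonic_convexity ::
    "(real ^ 'n::finite \<Rightarrow> real) \<Rightarrow> real ^ 'n \<Rightarrow> real ^ 'n \<Rightarrow> real \<Rightarrow> real" where
  "harmonic_convexity g x1 x3 t =
     g (t *\<^sub>R x1 + (1 - t) *\<^sub>R x3) - g x1 * g x3 / ((1 - t) * g x1 + t * g x3)"

text \<open>The essential supremum norm, with value \<open>\<infinity>\<close> for essentially unbounded or non-measurable functions.\<close>

definition Linf_norm :: "(real ^ 'n::finite) set \<Rightarrow> (real ^ 'n \<Rightarrow> real) \<Rightarrow> ereal" where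
  "Linf_norm S w = esssup (lebesgue_on S) (\<lambda>x. ereal \<bar>w x\<bar>)"

end

theory Submission
  imports Defs
begin

text \<open>
  Put \<open>\<alpha> = \<gamma> / (1 + 2 * \<gamma>)\<close> and \<open>w = u powr \<alpha>\<close>. The exponent is chosen so that the equation for \<open>u\<close>
  turns into
  \<open>- \<Delta>w = \<alpha> * (A / w + f / w powr (1 + 1 / \<gamma>) - g)\<close>,
  where \<open>A\<close> is a nonnegative multiple of the squared gradient of \<open>w\<close>. The proof is a quantitative
  version of the concavity maximum principle of Korevaar, Kennington and Kawohl. It studies the
  minimum of
  \<open>gap x1 x3 t = w (t x1 + (1 - t) x3) - t w x1 - (1 - t) w x3\<close>
  over the compact set of all \<open>x1\<close>, \<open>x3\<close> in the closed domain and \<open>t\<close> in the unit interval, and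
  shows that it is at least \<open>- K * \<delta>\<close> with \<open>K = m / (c * (1 + 1 / \<gamma>))\<close>.

  A negative minimum is not attained with an end point on the boundary (\<open>no_boundary_minimum\<close>). Since
  \<open>u\<close> vanishes there, \<open>\<Delta>u\<close> is close to \<open>- f\<close>, hence strictly negative, near the boundary. A
  comparison with a paraboloid on an interior touching ball shows that \<open>u\<close> grows at least linearly
  along the inner normal. As \<open>\<alpha> < 1\<close>, the function \<open>w\<close> has infinite slope, and pushing the end point
  inwards would lower the gap.

  At an interior minimum (\<open>interior_minimum_bound\<close>) the gradients of \<open>w\<close> at \<open>x1\<close>, \<open>x3\<close> and at the
  intermediate point \<open>x2\<close> agree, so all three equations share the same \<open>A\<close>. Moving \<open>x1\<close> and \<open>x3\<close>
  with different speeds \<open>a\<close> and \<open>b\<close>, where \<open>t * a + (1 - t) * b = 1\<close>, the second-order condition gives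
  \<open>\<Delta>w(x2) \<ge> t * a\<^sup>2 * \<Delta>w(x1) + (1 - t) * b\<^sup>2 * \<Delta>w(x3)\<close>. Optimising over \<open>a\<close> and \<open>b\<close> turns the
  right-hand side into a harmonic mean. The source \<open>A / w + f / w powr (1 + 1 / \<gamma>)\<close> has a reciprocal
  that is jointly convex in \<open>w\<close> and \<open>f powr \<gamma>\<close>; this is where \<open>\<gamma> \<ge> 1\<close> and the concavity of
  \<open>f powr \<gamma>\<close> enter (\<open>reciprocal_source_convex\<close>). The function \<open>g\<close> deviates from the corresponding
  inequality by at most \<open>\<delta>\<close>. Together these bound the difference of the source at \<open>w x2\<close> and at
  the larger value \<open>t w x1 + (1 - t) w x3\<close> by \<open>\<delta>\<close>. The source is strictly decreasing in \<open>w\<close>, with a rate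
  controlled by \<open>c\<close>, \<open>m\<close> and \<open>\<gamma>\<close>, so the two values differ by at most \<open>K * \<delta>\<close>
  (\<open>concavity_defect_bound\<close>).

  Finally, the concave envelope of a function with concavity defect \<open>K * \<delta>\<close> exceeds it by at most a
  dimensional multiple of \<open>K * \<delta>\<close> (\<open>hyers_ulam_concave\<close>), by Caratheodory's theorem applied to the
  convex hull of the graph.
\<close>

section \<open>Second-order jets of functions of one variable\<close>

text \<open>A jet describes the restriction of a function to a coordinate line. The first derivative exists near \<open>0\<close>
  and the second one at \<open>0\<close>, which matches what \<open>C2_on\<close> provides for such restrictions.\<close>
definition jet2 :: "(real \<Rightarrow> real) \<Rightarrow> real \<Rightarrow> real \<Rightarrow> bool" where
  "jet2 \<phi> p q \<longleftrightarrow> (\<exists>\<phi>'. (\<forall>\<^sub>F t in nhds 0. (\<phi> has_real_derivative \<phi>' t) (at t)) \<and>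
      \<phi>' 0 = p \<and> (\<phi>' has_real_derivative q) (at 0))"

lemma jet2_first: "jet2 \<phi> p q \<Longrightarrow> (\<phi> has_real_derivative p) (at 0)"
  unfolding jet2_def by (auto dest: eventually_nhds_x_imp_x)

lemma jet2_diff:
  assumes "jet2 \<phi> p q" "jet2 \<psi> p' q'"
  shows "jet2 (\<lambda>t. \<phi> t - \<psi> t) (p - p') (q - q')"
proof -
  obtain \<phi>' where 1: "\<forall>\<^sub>F t in nhds 0. (\<phi> has_real_derivative \<phi>' t) (at t)"
    "\<phi>' 0 = p" "(\<phi>' has_real_derivative q) (at 0)" using assms(1) unfolding jet2_def by auto
  obtain \<psi>' where 2: "\<forall>\<^sub>F t in nhds 0. (\<psi> has_real_derivative \<psi>' t) (at t)"
    "\<psi>' 0 = p'" "(\<psi>' has_real_derivative q') (at 0)" using assms(2) unfolding jet2_def by auto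
  have "\<forall>\<^sub>F t in nhds 0. ((\<lambda>t. \<phi> t - \<psi> t) has_real_derivative \<phi>' t - \<psi>' t) (at t)"
    using 1(1) 2(1) by eventually_elim (rule DERIV_diff)
  moreover have "((\<lambda>t. \<phi>' t - \<psi>' t) has_real_derivative q - q') (at 0)"
    using 1(3) 2(3) by (rule DERIV_diff)
  ultimately show ?thesis unfolding jet2_def using 1(2) 2(2)
    by (intro exI[of _ "\<lambda>t. \<phi>' t - \<psi>' t"]) auto
qed

lemma jet2_cmult:
  assumes "jet2 \<phi> p q"
  shows "jet2 (\<lambda>t. k * \<phi> t) (k * p) (k * q)"
proof -
  obtain \<phi>' where 1: "\<forall>\<^sub>F t in nhds 0. (\<phi> has_real_derivative \<phi>' t) (at t)"
    "\<phi>' 0 = p" "(\<phi>' has_real_derivative q) (at 0)" using assms(1) unfolding jet2_def by auto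
  have "\<forall>\<^sub>F t in nhds 0. ((\<lambda>t. k * \<phi> t) has_real_derivative k * \<phi>' t) (at t)"
    using 1(1) by eventually_elim (rule DERIV_cmult)
  moreover have "((\<lambda>t. k * \<phi>' t) has_real_derivative k * q) (at 0)"
    using 1(3) by (rule DERIV_cmult)
  ultimately show ?thesis unfolding jet2_def using 1(2)
    by (intro exI[of _ "\<lambda>t. k * \<phi>' t"]) auto
qed

lemma jet2_scale:
  assumes "jet2 \<phi> p q"
  shows "jet2 (\<lambda>t. \<phi> (a * t)) (a * p) (a\<^sup>2 * q)"
proof -
  obtain \<phi>' where 1: "\<forall>\<^sub>F t in nhds 0. (\<phi> has_real_derivative \<phi>' t) (at t)"
    "\<phi>' 0 = p" "(\<phi>' has_real_derivative q) (at 0)" using assms(1) unfolding jet2_def by auto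
  have "((\<lambda>t. a * t) \<longlongrightarrow> a * 0) (nhds 0)"
    by (intro tendsto_intros filterlim_ident)
  hence "filterlim (\<lambda>t. a * t) (nhds 0) (nhds 0)" by simp
  from eventually_compose_filterlim[OF 1(1) this]
  have "\<forall>\<^sub>F t in nhds 0. (\<phi> has_real_derivative \<phi>' (a * t)) (at (a * t))" .
  hence "\<forall>\<^sub>F t in nhds 0. ((\<lambda>t. \<phi> (a * t)) has_real_derivative a * \<phi>' (a * t)) (at t)"
  proof eventually_elim
    case (elim t)
    have "((\<lambda>t. a * t) has_real_derivative a) (at t)" by (auto intro!: derivative_eq_intros)
    from DERIV_chain2[where g = "\<lambda>t. a * t", OF elim this] show ?case
      by (simp add: mult.commute)
  qed
  moreover have "((\<lambda>t. a * \<phi>' (a * t)) has_real_derivative a * (q * a)) (at 0)"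
  proof (rule DERIV_cmult, rule DERIV_chain2[where g = "\<lambda>t. a * t"])
    show "(\<phi>' has_real_derivative q) (at (a * 0))" using 1(3) by simp
    show "((*) a has_real_derivative a) (at 0)" by (auto intro!: derivative_eq_intros)
  qed
  ultimately show ?thesis unfolding jet2_def using 1(2)
    by (intro exI[of _ "\<lambda>t. a * \<phi>' (a * t)"]) (auto simp: power2_eq_square mult_ac)
qed

lemma jet2_powr:
  assumes "jet2 \<phi> p q" "\<phi> 0 > 0"
  shows "jet2 (\<lambda>t. \<phi> t powr \<alpha>) (\<alpha> * \<phi> 0 powr (\<alpha> - 1) * p)
     (\<alpha> * \<phi> 0 powr (\<alpha> - 1) * q + \<alpha> * (\<alpha> - 1) * \<phi> 0 powr (\<alpha> - 2) * p\<^sup>2)"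
proof -
  obtain \<phi>' where 1: "\<forall>\<^sub>F t in nhds 0. (\<phi> has_real_derivative \<phi>' t) (at t)"
    "\<phi>' 0 = p" "(\<phi>' has_real_derivative q) (at 0)" using assms(1) unfolding jet2_def by auto
  have d0: "(\<phi> has_real_derivative p) (at 0)" using 1(1,2) eventually_nhds_x_imp_x by blast
  hence "isCont \<phi> 0" by (rule DERIV_isCont)
  hence "(\<phi> \<longlongrightarrow> \<phi> 0) (nhds 0)" by (simp add: isCont_def tendsto_at_iff_tendsto_nhds)
  hence pos: "\<forall>\<^sub>F t in nhds 0. \<phi> t > 0" using assms(2) by (rule order_tendstoD)
  have "\<forall>\<^sub>F t in nhds 0. ((\<lambda>t. \<phi> t powr \<alpha>) has_real_derivative \<alpha> * \<phi> t powr (\<alpha> - 1) * \<phi>' t) (at t)"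
    using 1(1) pos
  proof eventually_elim
    case (elim t)
    show ?case using has_real_derivative_powr[OF elim(2), of \<alpha>] elim(1) by (rule DERIV_chain2)
  qed
  moreover have "((\<lambda>t. \<alpha> * \<phi> t powr (\<alpha> - 1) * \<phi>' t) has_real_derivative
     \<alpha> * ((\<alpha> - 1) * \<phi> 0 powr (\<alpha> - 1 - 1) * p) * \<phi>' 0 + q * (\<alpha> * \<phi> 0 powr (\<alpha> - 1))) (at 0)"
    by (intro DERIV_mult DERIV_cmult DERIV_chain2[OF has_real_derivative_powr[OF assms(2)] d0] 1(3))
  ultimately show ?thesis unfolding jet2_def using 1(2)
    by (intro exI[of _ "\<lambda>t. \<alpha> * \<phi> t powr (\<alpha> - 1) * \<phi>' t"]) (auto simp: power2_eq_square algebra_simps)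
qed

text \<open>If the second derivative were negative, the first one, which vanishes at \<open>0\<close>, would be negative just
  to the right of \<open>0\<close> and the function would drop below its minimum.\<close>
lemma jet2_local_min:
  assumes j: "jet2 \<phi> p q" and min: "\<forall>\<^sub>F t in nhds 0. \<phi> 0 \<le> \<phi> t"
  shows "p = 0" "q \<ge> 0"
proof -
  obtain \<phi>' where 1: "\<forall>\<^sub>F t in nhds 0. (\<phi> has_real_derivative \<phi>' t) (at t)"
    "\<phi>' 0 = p" "(\<phi>' has_real_derivative q) (at 0)" using j unfolding jet2_def by auto
  obtain d where d: "d > 0" "\<And>t. \<bar>t\<bar> < d \<Longrightarrow> (\<phi> has_real_derivative \<phi>' t) (at t)"
    "\<And>t. \<bar>t\<bar> < d \<Longrightarrow> \<phi> 0 \<le> \<phi> t"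
    using eventually_conj[OF 1(1) min] unfolding eventually_nhds_metric dist_real_def by auto
  show p: "p = 0" using DERIV_local_min[OF jet2_first[OF j] d(1)] d(3) by auto
  show "q \<ge> 0"
  proof (rule ccontr)
    assume "\<not> q \<ge> 0"
    then obtain e where e: "e > 0" "\<And>h. h > 0 \<Longrightarrow> h < e \<Longrightarrow> \<phi>' (0 + h) < \<phi>' 0"
      using DERIV_neg_dec_right[OF 1(3)] by auto
    define h where "h = min d e / 2"
    have h: "h > 0" "h < d" "h < e" using d(1) e(1) by (auto simp: h_def min_def)
    have "\<phi> h < \<phi> 0"
    proof (rule DERIV_neg_imp_decreasing_open[OF h(1)])
      fix t assume t: "0 < t" "t < h"
      show "\<exists>y. (\<phi> has_real_derivative y) (at t) \<and> y < 0"
        using d(2)[of t] e(2)[of t] t h 1(2) p by auto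
    next
      show "continuous_on {0..h} \<phi>"
        by (rule DERIV_atLeastAtMost_imp_continuous_on) (use d(2) h in force)
    qed
    with d(3)[of h] h show False by auto
  qed
qed

lemma filterlim_line_nhds:
  fixes x e :: "'a::real_normed_vector"
  shows "filterlim (\<lambda>t. x + t *\<^sub>R e) (nhds x) (nhds 0)"
proof -
  have "((\<lambda>t. x + t *\<^sub>R e) \<longlongrightarrow> x + 0 *\<^sub>R e) (nhds 0)"
    by (intro tendsto_intros filterlim_ident)
  thus ?thesis by simp
qed

lemma eventually_on_line:
  fixes x e :: "'a::real_normed_vector"
  assumes "open S" "x \<in> S"
  shows "\<forall>\<^sub>F t in nhds 0. x + t *\<^sub>R e \<in> S"
  using topological_tendstoD[OF filterlim_line_nhds assms] .

lemma jet2_along_axis: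
  fixes u :: "real ^ 'n::finite \<Rightarrow> real"
  assumes "open S" "C2_on S u" "x \<in> S"
  shows "jet2 (\<lambda>t. u (x + t *\<^sub>R axis i 1)) (partial_deriv i u x) (partial_deriv i (partial_deriv i u) x)"
proof -
  have D: "((\<lambda>t. v (x + t *\<^sub>R axis i 1)) has_real_derivative partial_deriv i v (x + t *\<^sub>R axis i 1)) (at t)"
    if "C1_on S v" "x + t *\<^sub>R axis i 1 \<in> S" for v t
  proof -
    let ?y = "x + t *\<^sub>R axis i 1"
    have "v differentiable (at ?y)" using that unfolding C1_on_def by auto
    hence "(\<lambda>s. v (?y + s *\<^sub>R axis i 1)) differentiable (at 0)"
      by (intro differentiable_compose[of v "\<lambda>s. ?y + s *\<^sub>R axis i 1"]) auto
    hence "((\<lambda>s. v (?y + s *\<^sub>R axis i 1)) has_real_derivative partial_deriv i v ?y) (at 0)"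
      unfolding partial_deriv_def
      by (meson DERIV_deriv_iff_real_differentiable)
    hence "((\<lambda>s. v (?y + (s - t) *\<^sub>R axis i 1)) has_real_derivative partial_deriv i v ?y * 1) (at t)"
      by (intro DERIV_chain2[where g = "\<lambda>s. s - t"]) (auto intro!: derivative_eq_intros)
    thus ?thesis by (simp add: algebra_simps)
  qed
  have "\<forall>\<^sub>F t in nhds 0. x + t *\<^sub>R axis i 1 \<in> S"
    by (rule eventually_on_line) fact+
  hence "\<forall>\<^sub>F t in nhds 0. ((\<lambda>t. u (x + t *\<^sub>R axis i 1)) has_real_derivative partial_deriv i u (x + t *\<^sub>R axis i 1)) (at t)"
    by eventually_elim (use D assms(2) in \<open>auto simp: C2_on_def\<close>)
  moreover have "((\<lambda>t. partial_deriv i u (x + t *\<^sub>R axis i 1)) has_real_derivative partial_deriv i (partial_deriv i u) x) (at 0)"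
    using D[of "partial_deriv i u" 0] assms unfolding C2_on_def by auto
  ultimately show ?thesis unfolding jet2_def
    by (intro exI[of _ "\<lambda>t. partial_deriv i u (x + t *\<^sub>R axis i 1)"]) auto
qed

section \<open>Harmonic concavity of the transformed nonlinearity\<close>

text \<open>With \<open>\<rho> = y powr q / (A * y powr q + 1)\<close>, which increases with \<open>y\<close> and satisfies \<open>A * \<rho> \<le> 1\<close>, the
  derivative is \<open>(1 + q) * \<rho> - q * A * \<rho>\<^sup>2\<close>. This is increasing in \<open>\<rho>\<close> on the relevant range because
  \<open>q \<le> 1\<close>.\<close>
lemma convex_powr_quotient:
  fixes A q :: real
  assumes "A \<ge> 0" "0 < q" "q \<le> 1"
  shows "convex_on {0<..} (\<lambda>y. y powr (1 + q) / (A * y powr q + 1))"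
proof (rule convex_on_realI)
  define \<rho> where "\<rho> y = y powr q / (A * y powr q + 1)" for y :: real
  show "connected {0::real<..}" by simp
  fix y :: real assume "y \<in> {0<..}"
  hence y: "y > 0" by simp
  have N: "A * y powr q + 1 > 0" using assms y by (simp add: add_nonneg_pos)
  have s: "y powr (1 + q) * y powr (q - 1) = (y powr q)\<^sup>2"
    using y by (simp add: power2_eq_square flip: powr_add)
  have "((\<lambda>y. y powr (1 + q) / (A * y powr q + 1)) has_real_derivative
     ((1 + q) * y powr (1 + q - 1) * (A * y powr q + 1) - y powr (1 + q) * (A * (q * y powr (q - 1)) + 0)) /
     ((A * y powr q + 1) * (A * y powr q + 1))) (at y)"
    by (intro DERIV_divide DERIV_add DERIV_cmult has_real_derivative_powr y DERIV_const) (use N in simp)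
  also have "y powr (1 + q) * (A * (q * y powr (q - 1)) + 0) = A * q * (y powr q)\<^sup>2"
    using s by (simp add: algebra_simps)
  also have "((1 + q) * y powr (1 + q - 1) * (A * y powr q + 1) - A * q * (y powr q)\<^sup>2) /
     ((A * y powr q + 1) * (A * y powr q + 1)) = (1 + q) * \<rho> y - q * A * (\<rho> y)\<^sup>2"
    unfolding \<rho>_def using N by (simp add: divide_simps power2_eq_square)
  finally show "((\<lambda>y. y powr (1 + q) / (A * y powr q + 1)) has_real_derivative
     (1 + q) * \<rho> y - q * A * (\<rho> y)\<^sup>2) (at y)" .
next
  fix y z :: real assume yz: "y \<in> {0<..}" "z \<in> {0<..}" "y \<le> z"
  let ?r = "y powr q / (A * y powr q + 1)" and ?s = "z powr q / (A * z powr q + 1)"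
  have le: "y powr q \<le> z powr q" using yz assms by (intro powr_mono2) auto
  have N: "A * y powr q + 1 > 0" "A * z powr q + 1 > 0"
    using assms yz by (simp_all add: add_nonneg_pos)
  have rs: "?r \<le> ?s" using N le by (simp add: divide_simps) (simp add: algebra_simps)
  have "A * ?r \<le> 1" "A * ?s \<le> 1" using N by (simp_all add: divide_simps)
  hence "A * (?r + ?s) \<le> 2" by (simp add: algebra_simps)
  hence "q * (A * (?r + ?s)) \<le> q * 2" using assms by (intro mult_left_mono) auto
  hence "0 \<le> (?s - ?r) * ((1 + q) - q * A * (?r + ?s))"
    using rs assms by (intro mult_nonneg_nonneg) (auto simp: algebra_simps)
  also have "\<dots> = ((1 + q) * ?s - q * A * ?s\<^sup>2) - ((1 + q) * ?r - q * A * ?r\<^sup>2)"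
    by (simp add: algebra_simps power2_eq_square del: times_divide_eq_left times_divide_eq_right)
  finally show "(1 + q) * ?r - q * A * ?r\<^sup>2 \<le> (1 + q) * ?s - q * A * ?s\<^sup>2" by simp
qed

lemma perspective_quotient:
  fixes F w :: real
  assumes "F > 0" "w > 0" 
  shows "F * ((w / F) powr (1 + q) / (A * (w / F) powr q + 1)) = w powr (1 + q) / (A * w powr q + F powr q)"
proof -
  have "w powr (1 + q) = w * w powr q" "(w / F) powr (1 + q) = (w / F) * (w / F) powr q"
    using assms by (simp_all add: powr_add)
  moreover have "(w / F) powr q = w powr q / F powr q" using assms by (simp add: powr_divide)
  moreover have "A * (w powr q / F powr q) + 1 = (A * w powr q + F powr q) / F powr q"
    using assms by (simp add: field_simps)
  ultimately show ?thesis using assms by simp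
qed

text \<open>With \<open>F = f powr \<gamma>\<close> and \<open>q = 1 / \<gamma>\<close>, the fraction is the reciprocal of \<open>A / w + f / w powr (1 + q)\<close>. It is
  the perspective \<open>F * \<phi> (w / F)\<close> of a convex function \<open>\<phi>\<close>, hence jointly convex in \<open>(F, w)\<close>, and it
  decreases in \<open>F\<close>, so an inequality for \<open>F2\<close> suffices.\<close>
lemma reciprocal_source_convex:
  fixes A q l :: real
  assumes A: "A \<ge> 0" and q: "0 < q" "q \<le> 1" and l: "0 \<le> l" "l \<le> 1"
    and pos: "F1 > 0" "F3 > 0" "w1 > 0" "w3 > 0"
    and F2: "F2 \<ge> l * F1 + (1 - l) * F3"
    and w: "w = l * w1 + (1 - l) * w3"
  shows "w powr (1 + q) / (A * w powr q + F2 powr q)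
     \<le> l * (w1 powr (1 + q) / (A * w1 powr q + F1 powr q)) +
       (1 - l) * (w3 powr (1 + q) / (A * w3 powr q + F3 powr q))"
proof -
  let ?\<phi> = "\<lambda>y. y powr (1 + q) / (A * y powr q + 1)"
  define F where "F = l * F1 + (1 - l) * F3"
  have cpos: "l * x + (1 - l) * y > 0" if "x > 0" "y > 0" for x y :: real
    using that l by (cases "l = 0") (auto intro: add_pos_nonneg)
  have F: "F > 0" "F \<le> F2" and wp: "w > 0" using cpos pos F2 w by (auto simp: F_def)
  have "w / F = (l * F1 / F) * (w1 / F1) + ((1 - l) * F3 / F) * (w3 / F3)"
    using pos F(1) by (simp add: w divide_simps)
  also have "?\<phi> \<dots> \<le> (l * F1 / F) * ?\<phi> (w1 / F1) + ((1 - l) * F3 / F) * ?\<phi> (w3 / F3)"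
  proof -
    have "1 - (1 - l) * F3 / F = l * F1 / F" using F(1) by (simp add: F_def divide_simps)
    moreover have "0 \<le> (1 - l) * F3 / F" "(1 - l) * F3 / F \<le> 1"
      using l pos F(1) by (simp_all add: F_def)
    ultimately show ?thesis
      using convex_onD[OF convex_powr_quotient[OF A q], of "(1 - l) * F3 / F" "w1 / F1" "w3 / F3"] pos
      by simp
  qed
  finally have "F * ?\<phi> (w / F) \<le> F * ((l * F1 / F) * ?\<phi> (w1 / F1) + ((1 - l) * F3 / F) * ?\<phi> (w3 / F3))"
    using F(1) by (intro mult_left_mono) auto
  also have "F * ((l * F1 / F) * X + ((1 - l) * F3 / F) * Y) = l * (F1 * X) + (1 - l) * (F3 * Y)" for X Y
    using F(1) by (simp add: distrib_left)
  finally have *: "w powr (1 + q) / (A * w powr q + F powr q)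
     \<le> l * (w1 powr (1 + q) / (A * w1 powr q + F1 powr q)) +
       (1 - l) * (w3 powr (1 + q) / (A * w3 powr q + F3 powr q))"
    by (simp only: perspective_quotient pos F(1) wp)
  have "F powr q \<le> F2 powr q" using F q by (intro powr_mono2) auto
  hence "w powr (1 + q) / (A * w powr q + F2 powr q) \<le> w powr (1 + q) / (A * w powr q + F powr q)"
    using A F wp by (intro divide_left_mono mult_pos_pos add_nonneg_pos add_left_mono) auto
  with * show ?thesis by linarith
qed

text \<open>The next two lemmas say that the minimum of \<open>l * a\<^sup>2 * G1 + (1 - l) * b\<^sup>2 * G3\<close> under the constraint
  \<open>l * a + (1 - l) * b = 1\<close> is the weighted harmonic mean of \<open>G1\<close> and \<open>G3\<close>. The lower bound is the
  Cauchy-Schwarz inequality.\<close>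
lemma harmonic_mean_le:
  fixes a b l G1 G3 :: real
  assumes l: "0 \<le> l" "l \<le> 1" and ab: "l * a + (1 - l) * b = 1" and G: "G1 > 0" "G3 > 0"
  shows "G1 * G3 / ((1 - l) * G1 + l * G3) \<le> l * a\<^sup>2 * G1 + (1 - l) * b\<^sup>2 * G3"
proof -
  have N: "(1 - l) * G1 + l * G3 > 0"
    using l G by (cases "l = 0") (auto intro: add_nonneg_pos)
  have "(l * a\<^sup>2 * G1 + (1 - l) * b\<^sup>2 * G3) * ((1 - l) * G1 + l * G3) - G1 * G3 * (l * a + (1 - l) * b)\<^sup>2
     = l * (1 - l) * (a * G1 - b * G3)\<^sup>2"
    by (simp add: power2_eq_square algebra_simps)
  also have "\<dots> \<ge> 0" using l by simp
  finally show ?thesis using N ab by (simp add: pos_divide_le_eq)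
qed

text \<open>The optimal \<open>a\<close> and \<open>b\<close> are proportional to \<open>1 / H1\<close> and \<open>1 / H3\<close>.\<close>
lemma harmonic_mean_attained:
  fixes l H1 H2 H3 :: real
  assumes l: "0 \<le> l" "l \<le> 1" and H: "H1 > 0" "H3 > 0" "H2 > 0"
    and le: "1 / H2 \<le> l * (1 / H1) + (1 - l) * (1 / H3)"
  obtains a b where "l * a + (1 - l) * b = 1" "l * a\<^sup>2 * H1 + (1 - l) * b\<^sup>2 * H3 \<le> H2"
proof
  define S where "S = l * (1 / H1) + (1 - l) * (1 / H3)"
  have S: "S > 0" using le H unfolding S_def by (smt (verit) divide_pos_pos)
  show "l * (1 / H1 / S) + (1 - l) * (1 / H3 / S) = 1"
  proof -
    have "l * (1 / H1 / S) + (1 - l) * (1 / H3 / S) = (l * (1 / H1) + (1 - l) * (1 / H3)) / S"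
      by (simp add: add_divide_distrib)
    thus ?thesis unfolding S_def[symmetric] using S by simp
  qed
  have "l * (1 / H1 / S)\<^sup>2 * H1 + (1 - l) * (1 / H3 / S)\<^sup>2 * H3 = (l * (1 / H1) + (1 - l) * (1 / H3)) / S\<^sup>2"
    using H S by (simp add: power2_eq_square divide_simps)
  also have "\<dots> = 1 / S" unfolding S_def[symmetric] using S by (simp add: power2_eq_square)
  also have "\<dots> \<le> H2" using le H S unfolding S_def[symmetric] by (simp add: field_simps)
  finally show "l * (1 / H1 / S)\<^sup>2 * H1 + (1 - l) * (1 / H3 / S)\<^sup>2 * H3 \<le> H2" .
qed

text \<open>The pointwise core of the interior estimate. The premise \<open>test\<close> is the second-order condition at a
  minimum, with the equation for \<open>w\<close> inserted. It is applied with the weights \<open>a\<close> and \<open>b\<close> that are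
  optimal for the source \<open>H f w = A / w + f / w powr (1 + q)\<close> alone. For these weights the terms with
  \<open>g\<close> still dominate their harmonic mean, so they contribute an error of at most \<open>\<delta>\<close>.\<close>
lemma concavity_defect_bound:
  fixes q l A \<delta> c m :: real
  assumes A: "A \<ge> 0" and q: "0 < q" "q \<le> 1" and l: "0 \<le> l" "l \<le> 1" and c: "c > 0" and m: "m > 0"
    and f: "f1 > 0" "f3 > 0" "f2 \<ge> c"
    and w: "w1 > 0" "w3 > 0" "w2 > 0" "l * w1 + (1 - l) * w3 \<le> m powr (1 / (2 + q))"
    and G: "G1 > 0" "G3 > 0"
    and fconc: "f2 powr (1 / q) \<ge> l * f1 powr (1 / q) + (1 - l) * f3 powr (1 / q)"
    and HC: "G2 - G1 * G3 / ((1 - l) * G1 + l * G3) \<le> \<delta>"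
    and test: "\<And>a b. l * a + (1 - l) * b = 1 \<Longrightarrow>
        A / w2 + f2 / w2 powr (1 + q) - G2 \<le>
        l * a\<^sup>2 * (A / w1 + f1 / w1 powr (1 + q) - G1) + (1 - l) * b\<^sup>2 * (A / w3 + f3 / w3 powr (1 + q) - G3)"
    and \<delta>: "\<delta> \<ge> 0"
  shows "l * w1 + (1 - l) * w3 - w2 \<le> m / (c * (1 + q)) * \<delta>"
proof (cases "w2 < l * w1 + (1 - l) * w3")
  case False
  moreover have "m / (c * (1 + q)) * \<delta> \<ge> 0" using m c q \<delta> by simp
  ultimately show ?thesis by linarith
next
  case lt: True
  define w where "w = l * w1 + (1 - l) * w3"
  have wp: "w > 0" using lt w by (simp add: w_def)
  have f2: "f2 > 0" using f c by simp
  define H where "H f x = A / x + f / x powr (1 + q)" for f x :: real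
  have Hinv: "1 / H f x = x powr (1 + q) / (A * x powr q + (f powr (1 / q)) powr q)"
    if "f > 0" "x > 0" for f x
  proof -
    have "x powr (1 + q) = x * x powr q" using that by (simp add: powr_add)
    moreover have "A * x powr q + f > 0" using that A by (intro add_nonneg_pos) auto
    ultimately show ?thesis using that q by (simp add: H_def powr_powr field_simps)
  qed
  have Hpos: "H f x > 0" if "f > 0" "x > 0" for f x
    using that A by (simp add: H_def add_nonneg_pos)
  have "1 / H f2 w \<le> l * (1 / H f1 w1) + (1 - l) * (1 / H f3 w3)"
    unfolding Hinv[OF f2 wp] Hinv[OF f(1) w(1)] Hinv[OF f(2) w(2)]
    by (rule reciprocal_source_convex) (use A q l f w fconc w_def in auto)
  from harmonic_mean_attained[OF l Hpos[OF f(1) w(1)] Hpos[OF f(2) w(2)] Hpos[OF f2 wp] this]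
  obtain a b where ab: "l * a + (1 - l) * b = 1" "l * a\<^sup>2 * H f1 w1 + (1 - l) * b\<^sup>2 * H f3 w3 \<le> H f2 w"
    by blast
  have "H f2 w2 - G2 \<le> l * a\<^sup>2 * (H f1 w1 - G1) + (1 - l) * b\<^sup>2 * (H f3 w3 - G3)"
    using test[OF ab(1)] by (simp add: H_def)
  hence "H f2 w2 - H f2 w \<le> \<delta>"
    using harmonic_mean_le[OF l ab(1) G] HC ab(2) by (simp add: algebra_simps)
  moreover have "A / w \<le> A / w2" using A lt w wp by (intro divide_left_mono) (auto simp: w_def)
  ultimately have "f2 / w2 powr (1 + q) - f2 / w powr (1 + q) \<le> \<delta>" by (simp add: H_def)
  hence 1: "f2 * (w2 powr (-(1 + q)) - w powr (-(1 + q))) \<le> \<delta>"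
    unfolding powr_minus[of _ "1 + q"] by (simp add: field_simps)
  \<comment> \<open>The mean value theorem quantifies the strict monotonicity of the source in \<open>w\<close>; the exponent
    of \<open>m\<close> in the bound for \<open>w\<close> is chosen such that the slope is at least a multiple of \<open>1 / m\<close>.\<close>
  have "\<exists>z>w2. z < w \<and> w powr (-(1 + q)) - w2 powr (-(1 + q)) = (w - w2) * (-(1 + q) * z powr (-(1 + q) - 1))"
  proof (rule MVT2)
    show "w2 < w" using lt by (simp add: w_def)
    show "((\<lambda>x. x powr (-(1 + q))) has_real_derivative -(1 + q) * x powr (-(1 + q) - 1)) (at x)"
      if "w2 \<le> x" for x
      using that w by (intro has_real_derivative_powr) auto
  qed
  then obtain z where z: "z > w2" "z < w"
    and eq: "w2 powr (-(1 + q)) - w powr (-(1 + q)) = (w - w2) * ((1 + q) * z powr (-(2 + q)))"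
    by (auto simp: algebra_simps)
  have "1 / m = (m powr (1 / (2 + q))) powr (-(2 + q))"
  proof -
    have "1 / (2 + q) * (-(2 + q)) = -1" using q by (simp add: divide_simps)
    thus ?thesis using m by (simp only: powr_powr) (simp add: powr_minus_divide)
  qed
  also have "\<dots> \<le> z powr (-(2 + q))"
    using z w q by (intro powr_mono2') (auto simp: w_def)
  finally have slope: "(w - w2) * ((1 + q) * (1 / m)) \<le> (w - w2) * ((1 + q) * z powr (-(2 + q)))"
    using z q by (intro mult_left_mono) auto
  have "c * ((w - w2) * ((1 + q) * (1 / m))) \<le> f2 * ((w - w2) * ((1 + q) * z powr (-(2 + q))))"
    by (rule mult_mono[OF f(3) slope]) (use c f2 z q m in auto)
  also have "\<dots> \<le> \<delta>" using 1 eq by simp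
  finally have "(w - w2) * (c * (1 + q)) \<le> m * \<delta>" using m by (simp add: field_simps)
  hence "w - w2 \<le> m * \<delta> / (c * (1 + q))" using c q by (subst pos_le_divide_eq) auto
  thus ?thesis by (simp add: w_def)
qed

section \<open>Growth of the solution at the boundary\<close>

lemma jet2_quadratic: "jet2 (\<lambda>t. a + b * t + k * t\<^sup>2) b (2 * k)"
  unfolding jet2_def
  by (intro exI[of _ "\<lambda>t. b + k * (2 * t)"]) (auto intro!: derivative_eq_intros always_eventually)

text \<open>The weak maximum principle, in the strict case: \<open>u\<close> minus the paraboloid has negative Laplacian, so
  its minimum over the closed ball is attained on the sphere, where it equals \<open>u\<close>.\<close>
lemma above_paraboloid:
  fixes u :: "real ^ 'n::finite \<Rightarrow> real" and \<kappa> :: real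
  assumes S: "open S" "C2_on S u" "ball y \<rho> \<subseteq> S"
    and cont: "continuous_on (cball y \<rho>) u" and nonneg: "\<And>x. x \<in> sphere y \<rho> \<Longrightarrow> u x \<ge> 0"
    and lap: "\<And>x. x \<in> ball y \<rho> \<Longrightarrow> laplacian u x < - (2 * CARD('n) * \<kappa>)"
    and x: "x \<in> cball y \<rho>"
  shows "\<kappa> * (\<rho>\<^sup>2 - (dist y x)\<^sup>2) \<le> u x"
proof -
  let ?h = "\<lambda>x. u x + \<kappa> * (dist y x)\<^sup>2"
  have "\<exists>z\<in>cball y \<rho>. \<forall>x\<in>cball y \<rho>. ?h z \<le> ?h x"
  proof (rule continuous_attains_inf)
    show "cball y \<rho> \<noteq> {}" using x by blast
  qed (auto intro!: continuous_intros cont)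
  then obtain z where z: "z \<in> cball y \<rho>" "\<And>x. x \<in> cball y \<rho> \<Longrightarrow> ?h z \<le> ?h x" by auto
  have "z \<notin> ball y \<rho>"
  proof
    assume zb: "z \<in> ball y \<rho>"
    have "partial_deriv i (partial_deriv i u) z \<ge> - (2 * \<kappa>)" for i
    proof -
      define p where "p t = - (\<kappa> * (dist y z)\<^sup>2) + (- (2 * \<kappa> * ((z - y) $ i))) * t + (- \<kappa>) * t\<^sup>2" for t :: real
      have p: "p t = - (\<kappa> * (dist y (z + t *\<^sub>R axis i 1))\<^sup>2)" for t
      proof -
        have "(dist y (z + t *\<^sub>R axis i 1))\<^sup>2 = (z - y + t *\<^sub>R axis i 1) \<bullet> (z - y + t *\<^sub>R axis i 1)"
          by (simp add: dist_commute[of y] dist_norm power2_norm_eq_inner algebra_simps)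
        also have "\<dots> = (z - y) \<bullet> (z - y) + 2 * t * ((z - y) $ i) + t\<^sup>2"
          by (simp add: inner_add_left inner_add_right inner_axis inner_axis' power2_eq_square
              inner_axis_axis distrib_left del: vector_minus_component)
        also have "(z - y) \<bullet> (z - y) = (dist y z)\<^sup>2"
          by (metis dist_commute dist_norm power2_norm_eq_inner)
        finally have sq: "(dist y (z + t *\<^sub>R axis i 1))\<^sup>2 = (dist y z)\<^sup>2 + 2 * t * ((z - y) $ i) + t\<^sup>2" .
        show ?thesis unfolding p_def sq by (simp add: algebra_simps del: vector_minus_component)
      qed
      have j: "jet2 (\<lambda>t. u (z + t *\<^sub>R axis i 1) - p t)
          (partial_deriv i u z - (- (2 * \<kappa> * ((z - y) $ i))))
          (partial_deriv i (partial_deriv i u) z - 2 * (- \<kappa>))"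
        unfolding p_def by (intro jet2_diff jet2_quadratic jet2_along_axis[OF S(1,2)]) (use zb S in auto)
      have "\<forall>\<^sub>F t in nhds 0. u (z + 0 *\<^sub>R axis i 1) - p 0 \<le> u (z + t *\<^sub>R axis i 1) - p t"
        using eventually_on_line[OF open_ball zb, of "axis i 1"]
      proof eventually_elim
        case (elim t)
        thus ?case using z(2)[of "z + t *\<^sub>R axis i 1"] by (simp add: p)
      qed
      from jet2_local_min(2)[OF j this] show ?thesis by simp
    qed
    hence "laplacian u z \<ge> (\<Sum>i\<in>(UNIV::'n set). - (2 * \<kappa>))"
      unfolding laplacian_def by (intro sum_mono) auto
    with lap[OF zb] show False by simp
  qed
  with z(1) have "dist y z = \<rho>" by auto
  with nonneg[of z] z(2)[OF x] show ?thesis by (simp add: algebra_simps)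
qed

text \<open>A form of Hopf's boundary point lemma. Since \<open>laplacian u\<close> stays away from \<open>0\<close> near \<open>x0\<close>, shrinking the
  interior touching ball towards \<open>x0\<close> allows a paraboloid as barrier, and that paraboloid has positive
  slope at the boundary of its ball.\<close>
lemma linear_growth_at_boundary:
  fixes u :: "real ^ 'n::finite \<Rightarrow> real"
  assumes S: "open S" "C2_on S u" "interior_ball_condition S" "x0 \<in> frontier S"
    and cont: "continuous_on (closure S) u" and nonneg: "\<And>x. x \<in> closure S \<Longrightarrow> u x \<ge> 0"
    and e: "e > 0" and \<eta>: "\<eta> > 0"
    and lap: "\<And>x. x \<in> S \<Longrightarrow> dist x0 x < e \<Longrightarrow> laplacian u x < - \<eta>"
  obtains \<nu> \<tau> \<sigma> where "\<tau> > 0" "\<sigma> > 0"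
    "\<forall>t\<in>{0..\<tau>}. x0 + t *\<^sub>R \<nu> \<in> closure S \<and> \<sigma> * t \<le> u (x0 + t *\<^sub>R \<nu>)"
proof -
  obtain y r where r: "r > 0" "ball y r \<subseteq> S" "dist y x0 = r"
    using S(3,4) unfolding interior_ball_condition_def by (metis mem_sphere)
  define \<rho> where "\<rho> = min r (e / 2)"
  have \<rho>: "\<rho> > 0" "\<rho> \<le> r" "2 * \<rho> \<le> e" using r e by (auto simp: \<rho>_def)
  define \<nu> where "\<nu> = (1 / r) *\<^sub>R (y - x0)"
  have n\<nu>: "norm \<nu> = 1" using r by (simp add: \<nu>_def dist_norm)
  have y: "y = x0 + r *\<^sub>R \<nu>" using r by (simp add: \<nu>_def)
  define y' where "y' = x0 + \<rho> *\<^sub>R \<nu>"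
  have dline: "dist y' (x0 + t *\<^sub>R \<nu>) = \<bar>\<rho> - t\<bar>" for t
    using n\<nu> by (simp add: y'_def dist_norm flip: scaleR_diff_left)
  have "dist y y' = r - \<rho>" using n\<nu> \<rho> by (simp add: y y'_def dist_norm flip: scaleR_diff_left)
  hence bS: "ball y' \<rho> \<subseteq> S" using r(2)
    by (smt (verit, best) dist_triangle mem_ball subset_iff)
  have "dist x0 y' = \<rho>" using n\<nu> \<rho> by (simp add: y'_def dist_norm)
  hence be: "dist x0 x < e" if "x \<in> ball y' \<rho>" for x
    using that \<rho>(3) dist_triangle[of x0 x y'] by auto
  have cS: "cball y' \<rho> \<subseteq> closure S"
    using closure_mono[OF bS] \<rho>(1) by simp
  define \<kappa> where "\<kappa> = \<eta> / (2 * CARD('n))"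
  have \<kappa>: "\<kappa> > 0" "2 * CARD('n) * \<kappa> = \<eta>" using \<eta> by (auto simp: \<kappa>_def)
  show thesis
  proof (rule that, safe)
    show "\<rho> > 0" "\<kappa> * \<rho> > 0" using \<rho> \<kappa> by auto
    fix t assume "t \<in> {0..\<rho>}"
    hence t: "0 \<le> t" "t \<le> \<rho>" by auto
    have xc: "x0 + t *\<^sub>R \<nu> \<in> cball y' \<rho>" using dline[of t] t by simp
    have "\<kappa> * (\<rho>\<^sup>2 - (dist y' (x0 + t *\<^sub>R \<nu>))\<^sup>2) \<le> u (x0 + t *\<^sub>R \<nu>)"
    proof (rule above_paraboloid[where S = S and u = u, OF _ _ _ _ _ _ xc])
      show "open S" "C2_on S u" "ball y' \<rho> \<subseteq> S" by fact+
      show "continuous_on (cball y' \<rho>) u" using cont cS continuous_on_subset by blast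
      show "u x \<ge> 0" if "x \<in> sphere y' \<rho>" for x
        using that cS by (intro nonneg) auto
      show "laplacian u x < - (2 * CARD('n) * \<kappa>)" if "x \<in> ball y' \<rho>" for x
        using lap[of x] be[OF that] that bS \<kappa>(2) by auto
    qed
    moreover have "\<kappa> * (\<rho>\<^sup>2 - (dist y' (x0 + t *\<^sub>R \<nu>))\<^sup>2) = \<kappa> * \<rho> * t + \<kappa> * (t * (\<rho> - t))"
      unfolding dline by (simp add: power2_eq_square algebra_simps)
    moreover have "\<kappa> * (t * (\<rho> - t)) \<ge> 0" using t \<kappa> by simp
    ultimately show "x0 + t *\<^sub>R \<nu> \<in> closure S" "\<kappa> * \<rho> * t \<le> u (x0 + t *\<^sub>R \<nu>)"
      using xc cS by auto
  qed
qed

lemma no_powr_growth_if_differentiable: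
  fixes W :: "real \<Rightarrow> real"
  assumes D: "(W has_real_derivative D) (at 0)" and k: "k > 0" "\<tau> > 0" "\<alpha> < 1"
    and growth: "\<And>t. 0 < t \<Longrightarrow> t \<le> \<tau> \<Longrightarrow> W 0 + k * t powr \<alpha> \<le> W t"
  shows False
proof -
  have "((\<lambda>h. (W (0 + h) - W 0) / h) \<longlongrightarrow> D) (at_right 0)"
    using D unfolding DERIV_def by (rule filterlim_mono) (auto simp: at_le)
  hence "\<forall>\<^sub>F h in at_right 0. (W (0 + h) - W 0) / h < \<bar>D\<bar> + 1"
    by (rule order_tendstoD) auto
  moreover have "\<forall>\<^sub>F h in at_right 0. h \<in> {0<..<\<tau>}"
    using k(2) by (rule eventually_at_right_real)
  ultimately have "\<forall>\<^sub>F h in at_right 0. k \<le> (\<bar>D\<bar> + 1) * h powr (1 - \<alpha>)"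
  proof eventually_elim
    case (elim h)
    hence h: "0 < h" "h < \<tau>" by auto
    have "k * h powr \<alpha> \<le> W h - W 0" using growth[of h] h by auto
    also have "\<dots> \<le> (\<bar>D\<bar> + 1) * h" using elim(1) h by (simp add: divide_simps)
    also have "(\<bar>D\<bar> + 1) * h = (\<bar>D\<bar> + 1) * h powr (1 - \<alpha>) * h powr \<alpha>"
      using h by (simp flip: powr_add)
    finally show ?case using h by simp
  qed
  moreover have "((\<lambda>h. (\<bar>D\<bar> + 1) * h powr (1 - \<alpha>)) \<longlongrightarrow> (\<bar>D\<bar> + 1) * 0) (at_right 0)"
  proof (intro tendsto_mult tendsto_const)
    show "((\<lambda>h. h powr (1 - \<alpha>)) \<longlongrightarrow> 0) (at_right 0)"
    proof (rule tendsto_zero_powrI)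
      show "((\<lambda>x. x) \<longlongrightarrow> (0::real)) (at_right 0)" by (simp add: filterlim_at_within_If tendsto_ident_at)
      show "\<forall>\<^sub>F x in at_right 0. (0::real) \<le> x"
        by (simp add: eventually_at_filter)
      show "((\<lambda>x. 1 - \<alpha>) \<longlongrightarrow> 1 - \<alpha>) (at_right (0::real))" by simp
    qed (use k in auto)
  qed
  ultimately have "k \<le> (\<bar>D\<bar> + 1) * 0"
    by (intro tendsto_lowerbound[where F = "at_right (0::real)"]) auto
  with k show False by simp
qed

section \<open>Approximately concave functions and the essential supremum\<close>

text \<open>Each further point in a convex combination costs one more defect \<open>K\<close>.\<close>
lemma jensen_defect:
  fixes w :: "'a::real_vector \<Rightarrow> real" and K :: real
  assumes S: "convex S" and K: "K \<ge> 0"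
    and two: "\<And>x y t. x \<in> S \<Longrightarrow> y \<in> S \<Longrightarrow> 0 \<le> t \<Longrightarrow> t \<le> 1 \<Longrightarrow>
        t * w x + (1 - t) * w y \<le> w (t *\<^sub>R x + (1 - t) *\<^sub>R y) + K"
    and A: "finite A" "A \<noteq> {}" "\<And>i. i \<in> A \<Longrightarrow> a i \<ge> 0" "sum a A = 1" "\<And>i. i \<in> A \<Longrightarrow> y i \<in> S"
  shows "(\<Sum>i\<in>A. a i * w (y i)) \<le> w (\<Sum>i\<in>A. a i *\<^sub>R y i) + card A * K"
  using A
proof (induction A arbitrary: a rule: finite_ne_induct)
  case (singleton i)
  thus ?case using K by simp
next
  case (insert i A)
  show ?case
  proof (cases "a i = 1")
    case True
    hence "sum a A = 0" using insert.hyps insert.prems by simp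
    hence z: "\<And>j. j \<in> A \<Longrightarrow> a j = 0"
      using insert.hyps insert.prems by (subst (asm) sum_nonneg_eq_0_iff) auto
    thus ?thesis using insert.hyps True K by simp
  next
    case False
    define s where "s = 1 - a i"
    have sA: "sum a A = s" using insert.hyps insert.prems by (simp add: s_def)
    have "sum a A \<ge> 0" using insert.prems by (intro sum_nonneg) auto
    hence s: "s > 0" "s \<le> 1" using False sA insert.prems(1)[of i] by (auto simp: s_def)
    define b where "b j = a j / s" for j
    have b: "\<And>j. j \<in> A \<Longrightarrow> b j \<ge> 0" "sum b A = 1"
      using s insert.prems sA by (auto simp: b_def simp flip: sum_divide_distrib)
    define yb where "yb = (\<Sum>j\<in>A. b j *\<^sub>R y j)"
    have ybS: "yb \<in> S" unfolding yb_def
      using S insert.hyps b insert.prems by (intro convex_sum) auto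
    have IH: "(\<Sum>j\<in>A. b j * w (y j)) \<le> w yb + card A * K"
      unfolding yb_def by (rule insert.IH) (use b insert.prems in auto)
    have ab: "a j = s * b j" for j using s by (simp add: b_def)
    have "(\<Sum>j\<in>insert i A. a j * w (y j)) = a i * w (y i) + s * (\<Sum>j\<in>A. b j * w (y j))"
      using insert.hyps by (simp add: sum_distrib_left) (simp add: ab mult.assoc)
    also have "\<dots> \<le> a i * w (y i) + s * (w yb + card A * K)"
      using IH s by simp
    also have "\<dots> \<le> a i * w (y i) + (1 - a i) * w yb + card A * K"
      using s K mult_right_mono[of s 1 "card A * K"] by (simp add: s_def algebra_simps)
    also have "\<dots> \<le> w (a i *\<^sub>R y i + (1 - a i) *\<^sub>R yb) + K + card A * K"
      using two[of "y i" yb "a i"] insert.prems ybS s by (simp add: s_def)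
    also have "(1 - a i) *\<^sub>R yb = (\<Sum>j\<in>A. a j *\<^sub>R y j)"
      unfolding yb_def s_def[symmetric] by (simp add: scaleR_sum_right ab)
    finally show ?thesis using insert.hyps by (simp add: algebra_simps)
  qed
qed

text \<open>The concave envelope \<open>v\<close> is the upper boundary of the convex hull of the graph of \<open>w\<close>. By
  Caratheodory's theorem in the product with the real line, every point of that hull is a combination of
  at most \<open>DIM('a) + 2\<close> points of the graph, which bounds the total Jensen defect.\<close>
lemma hyers_ulam_concave:
  fixes w :: "'a::euclidean_space \<Rightarrow> real" and K :: real
  assumes S: "convex S" and K: "K \<ge> 0"
    and two: "\<And>x y t. x \<in> S \<Longrightarrow> y \<in> S \<Longrightarrow> 0 \<le> t \<Longrightarrow> t \<le> 1 \<Longrightarrow>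
        t * w x + (1 - t) * w y \<le> w (t *\<^sub>R x + (1 - t) *\<^sub>R y) + K"
  obtains v where "concave_on S v" "\<forall>x\<in>S. w x \<le> v x \<and> v x \<le> w x + (DIM('a) + 2) * K"
proof -
  define H where "H = convex hull ((\<lambda>x. (x, w x)) ` S)"
  define v where "v x = Sup {t. (x, t) \<in> H}" for x
  have bound: "t \<le> w x + (DIM('a) + 2) * K" if xt: "(x, t) \<in> H" for x t
  proof -
    obtain T a where T: "finite T" "T \<subseteq> (\<lambda>x. (x, w x)) ` S" "card T \<le> DIM('a) + 2"
      "\<And>z. z \<in> T \<Longrightarrow> 0 \<le> a z" "sum a T = 1" "(\<Sum>z\<in>T. a z *\<^sub>R z) = (x, t)"
      using xt unfolding H_def convex_hull_caratheodory by auto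
    have Te: "T \<noteq> {}" using T(5) by auto
    have "t = (\<Sum>z\<in>T. a z * snd z)" using arg_cong[OF T(6), of snd] by (simp add: snd_sum)
    also have "\<dots> = (\<Sum>z\<in>T. a z * w (fst z))" using T(2) by (intro sum.cong) auto
    also have "\<dots> \<le> w (\<Sum>z\<in>T. a z *\<^sub>R fst z) + card T * K"
      using T(2) by (intro jensen_defect[OF S K two] T Te) auto
    also have "(\<Sum>z\<in>T. a z *\<^sub>R fst z) = x" using arg_cong[OF T(6), of fst] by (simp add: fst_sum)
    also have "w x + card T * K \<le> w x + (DIM('a) + 2) * K"
      using T(3) K by (intro add_left_mono mult_right_mono) (simp_all flip: of_nat_add)
    finally show ?thesis .
  qed
  hence bdd: "bdd_above {t. (x, t) \<in> H}" for x by (auto simp: bdd_above_def)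
  have graph: "(x, w x) \<in> H" if "x \<in> S" for x
    unfolding H_def using that by (intro hull_inc) auto
  show thesis
  proof
    have "w x \<le> v x" if "x \<in> S" for x
      unfolding v_def using graph[OF that] bdd by (intro cSup_upper) auto
    moreover have "v x \<le> w x + (DIM('a) + 2) * K" if "x \<in> S" for x
      unfolding v_def using graph[OF that] bound by (intro cSup_least) auto
    ultimately show "\<forall>x\<in>S. w x \<le> v x \<and> v x \<le> w x + (DIM('a) + 2) * K" by blast
    show "concave_on S v"
      unfolding concave_on_iff
    proof (intro conjI S ballI allI impI)
      fix x y :: 'a and a b :: real
      assume xy: "x \<in> S" "y \<in> S" and ab: "0 \<le> a" "0 \<le> b" "a + b = 1"
      have close: "\<exists>t. (z, t) \<in> H \<and> v z - e < t" if "z \<in> S" "e > 0" for z e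
        using less_cSupD[of "{t. (z, t) \<in> H}" "v z - e"] graph[OF that(1)] that(2)
        by (auto simp: v_def)
      show "a * v x + b * v y \<le> v (a *\<^sub>R x + b *\<^sub>R y)"
      proof (rule field_le_epsilon)
        fix e :: real assume e: "e > 0"
        obtain s where s: "(x, s) \<in> H" "v x - e < s" using close[OF xy(1) e] by auto
        obtain t where t: "(y, t) \<in> H" "v y - e < t" using close[OF xy(2) e] by auto
        have "a *\<^sub>R (x, s) + b *\<^sub>R (y, t) \<in> H"
          using convexD[OF _ s(1) t(1) ab] unfolding H_def by (simp add: convex_convex_hull)
        hence "a * s + b * t \<le> v (a *\<^sub>R x + b *\<^sub>R y)"
          unfolding v_def by (intro cSup_upper bdd) auto
        moreover have "a * (v x - e) + b * (v y - e) \<le> a * s + b * t"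
          using s t ab by (intro add_mono mult_left_mono) auto
        moreover have "a * (v x - e) + b * (v y - e) = a * v x + b * v y - (a + b) * e"
          by (simp add: algebra_simps)
        ultimately show "a * v x + b * v y \<le> v (a *\<^sub>R x + b *\<^sub>R y) + e" using ab by simp
      qed
    qed
  qed
qed

text \<open>A strict superlevel set of a continuous function is open, so it is empty as soon as it is null.\<close>
lemma le_Linf_norm_pointwise:
  fixes u :: "real ^ 'n::finite \<Rightarrow> real"
  assumes S: "open S" "continuous_on S u" and m: "Linf_norm S u = ereal m" and x: "x \<in> S"
  shows "u x \<le> m"
proof (rule ccontr)
  assume "\<not> u x \<le> m"
  have Sm: "S \<in> sets lebesgue" using S(1) by simp
  have "AE y in lebesgue_on S. ereal \<bar>u y\<bar> \<le> ereal m"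
    using esssup_AE[of "\<lambda>x. ereal \<bar>u x\<bar>" "lebesgue_on S"] m by (simp add: Linf_norm_def)
  hence "AE y in lebesgue. y \<in> S \<longrightarrow> u y \<le> m"
    using Sm by (subst (asm) AE_restrict_space_iff) auto
  then obtain N where N: "N \<in> null_sets lebesgue" "{y. \<not> (y \<in> S \<longrightarrow> u y \<le> m)} \<subseteq> N"
    unfolding eventually_ae_filter by auto
  let ?U = "S \<inter> u -` {m<..}"
  have "open ?U" using S by (intro continuous_open_preimage) auto
  moreover have "x \<in> ?U" using x \<open>\<not> u x \<le> m\<close> by auto
  moreover have "negligible ?U"
  proof (rule negligible_subset)
    show "negligible N" using N(1) by (simp add: negligible_iff_null_sets)
    show "?U \<subseteq> N" using N(2) by auto
  qed
  ultimately show False using open_not_negligible by blast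
qed

lemma Linf_norm_leI:
  fixes w :: "real ^ 'n::finite \<Rightarrow> real"
  assumes S: "open S" "continuous_on S w" and b: "\<And>x. x \<in> S \<Longrightarrow> \<bar>w x\<bar> \<le> B"
  shows "Linf_norm S w \<le> ereal B"
  unfolding Linf_norm_def
proof (rule esssup_I)
  have "w \<in> borel_measurable (lebesgue_on S)"
    using S by (intro continuous_imp_measurable_on_sets_lebesgue) auto
  thus "(\<lambda>x. ereal \<bar>w x\<bar>) \<in> borel_measurable (lebesgue_on S)" by measurable
  show "AE x in lebesgue_on S. ereal \<bar>w x\<bar> \<le> ereal B"
    using b by (intro AE_I2) auto
qed

section \<open>The concavity maximum principle\<close>

locale sublinear_dirichlet_problem =
  fixes \<Omega> :: "(real ^ 'n::finite) set" and f g u :: "real ^ 'n \<Rightarrow> real" and c m \<gamma> \<delta> :: real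
  assumes \<Omega>: "open \<Omega>" "\<Omega> \<noteq> {}" "bounded \<Omega>" "convex \<Omega>" "interior_ball_condition \<Omega>"
    and pars: "\<gamma> \<ge> 1" "c > 0" "\<delta> \<ge> 0"
    and g: "continuous_on (closure \<Omega>) g" "\<And>x. x \<in> \<Omega> \<Longrightarrow> g x > 0"
    and f_ge: "\<And>x. x \<in> \<Omega> \<Longrightarrow> f x \<ge> c"
    and f_conc: "concave_on \<Omega> (\<lambda>x. f x powr \<gamma>)"
    and u: "continuous_on (closure \<Omega>) u" "C2_on \<Omega> u"
    and pde: "\<And>x. x \<in> \<Omega> \<Longrightarrow> laplacian u x = u x powr ((1 + \<gamma>) / (1 + 2 * \<gamma>)) * g x - f x"
    and u_zero: "\<And>x. x \<in> frontier \<Omega> \<Longrightarrow> u x = 0"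
    and u_pos: "\<And>x. x \<in> \<Omega> \<Longrightarrow> u x > 0"
    and u_le: "\<And>x. x \<in> \<Omega> \<Longrightarrow> u x \<le> m"
    and HC: "\<And>x y t. x \<in> \<Omega> \<Longrightarrow> y \<in> \<Omega> \<Longrightarrow> 0 \<le> t \<Longrightarrow> t \<le> 1 \<Longrightarrow> harmonic_convexity g x y t \<le> \<delta>"
begin

definition \<alpha> :: real where "\<alpha> = \<gamma> / (1 + 2 * \<gamma>)"

definition w :: "real ^ 'n \<Rightarrow> real" where "w x = u x powr \<alpha>"

definition gap :: "real ^ 'n \<Rightarrow> real ^ 'n \<Rightarrow> real \<Rightarrow> real" where
  "gap x y t = w (t *\<^sub>R x + (1 - t) *\<^sub>R y) - (t * w x + (1 - t) * w y)"

lemma \<alpha>: "0 < \<alpha>" "\<alpha> < 1" "(1 + \<gamma>) / (1 + 2 * \<gamma>) = 1 - \<alpha>"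
  "\<alpha> * (1 + 1 / \<gamma>) = 1 - \<alpha>" "\<alpha> = 1 / (2 + 1 / \<gamma>)"
proof -
  show "0 < \<alpha>" "\<alpha> < 1" "(1 + \<gamma>) / (1 + 2 * \<gamma>) = 1 - \<alpha>" "\<alpha> = 1 / (2 + 1 / \<gamma>)"
    using pars by (auto simp: \<alpha>_def field_simps)
  have "\<gamma> * (1 + 1 / \<gamma>) = 1 + \<gamma>" using pars by (simp add: distrib_left)
  hence "\<alpha> * (1 + 1 / \<gamma>) = (1 + \<gamma>) / (1 + 2 * \<gamma>)" by (simp add: \<alpha>_def)
  thus "\<alpha> * (1 + 1 / \<gamma>) = 1 - \<alpha>" using \<open>(1 + \<gamma>) / (1 + 2 * \<gamma>) = 1 - \<alpha>\<close> by simp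
qed

lemma m_pos: "m > 0"
  using \<Omega>(2) u_pos u_le by (metis ex_in_conv less_le_trans)

lemma u_nonneg: "x \<in> closure \<Omega> \<Longrightarrow> u x \<ge> 0"
  using u_pos u_zero \<Omega>(1) by (metis DiffI frontier_def interior_open less_imp_le order_refl)

lemma w_pos: "x \<in> \<Omega> \<Longrightarrow> w x > 0"
  using u_pos[of x] by (simp add: w_def)

lemma w_frontier: "x \<in> frontier \<Omega> \<Longrightarrow> w x = 0"
  using u_zero \<alpha>(1) by (simp add: w_def)

lemma w_nonneg: "w x \<ge> 0"
  by (simp add: w_def)

lemma w_le: "x \<in> \<Omega> \<Longrightarrow> w x \<le> m powr (1 / (2 + 1 / \<gamma>))"
  using u_le[of x] u_pos[of x] \<alpha> unfolding w_def \<alpha>(5)[symmetric] by (intro powr_mono2) auto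

lemma continuous_w: "continuous_on (closure \<Omega>) w"
  unfolding w_def using u_nonneg \<alpha>(1)
  by (intro continuous_on_powr' u continuous_on_const) auto

text \<open>The first and second pure partial derivatives of \<open>w\<close> on \<open>\<Omega>\<close>, by the chain rule.\<close>
definition dw :: "'n \<Rightarrow> real ^ 'n \<Rightarrow> real" where
  "dw i x = \<alpha> * u x powr (\<alpha> - 1) * partial_deriv i u x"

definition ddw :: "'n \<Rightarrow> real ^ 'n \<Rightarrow> real" where
  "ddw i x = \<alpha> * u x powr (\<alpha> - 1) * partial_deriv i (partial_deriv i u) x
     + \<alpha> * (\<alpha> - 1) * u x powr (\<alpha> - 2) * (partial_deriv i u x)\<^sup>2"

lemma jet2_w:
  assumes "x \<in> \<Omega>"
  shows "jet2 (\<lambda>t. w (x + t *\<^sub>R axis i 1)) (dw i x) (ddw i x)"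
  using jet2_powr[OF jet2_along_axis[OF \<Omega>(1) u(2) assms, of i], of \<alpha>] u_pos[OF assms]
  unfolding w_def dw_def ddw_def by simp

text \<open>The equation for \<open>u\<close> in terms of \<open>w\<close>. The power \<open>1 - \<alpha>\<close> of \<open>u\<close> in front of \<open>g\<close> cancels against the
  factor \<open>u powr (\<alpha> - 1)\<close> from the chain rule, so that \<open>g\<close> enters without a power of \<open>w\<close>.\<close>
lemma equation_w:
  assumes x: "x \<in> \<Omega>"
  shows "(\<Sum>i\<in>UNIV. ddw i x) =
    - \<alpha> * (((1 - \<alpha>) / \<alpha>\<^sup>2 * (\<Sum>i\<in>UNIV. (dw i x)\<^sup>2)) / w x + f x / w x powr (1 + 1 / \<gamma>) - g x)"
proof -
  define G where "G = (\<Sum>i\<in>UNIV. (partial_deriv i u x)\<^sup>2)"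
  have ux: "u x > 0" using u_pos x by auto
  have s2: "(\<Sum>i\<in>UNIV. ddw i x) = \<alpha> * u x powr (\<alpha> - 1) * laplacian u x + \<alpha> * (\<alpha> - 1) * u x powr (\<alpha> - 2) * G"
    unfolding ddw_def G_def laplacian_def by (simp add: sum.distrib sum_distrib_left)
  have "(\<Sum>i\<in>UNIV. (dw i x)\<^sup>2) = \<alpha>\<^sup>2 * (u x powr (\<alpha> - 1))\<^sup>2 * G"
    unfolding dw_def G_def by (simp add: sum_distrib_left power_mult_distrib)
  also have "(u x powr (\<alpha> - 1))\<^sup>2 = u x powr (\<alpha> - 2) * w x"
    unfolding w_def power2_eq_square by (simp flip: powr_add)
  finally have s1: "(1 - \<alpha>) / \<alpha>\<^sup>2 * (\<Sum>i\<in>UNIV. (dw i x)\<^sup>2) / w x = (1 - \<alpha>) * u x powr (\<alpha> - 2) * G"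
    using w_pos[OF x] \<alpha>(1) by simp
  have "u x powr (\<alpha> - 1) * u x powr (1 - \<alpha>) = 1" using ux by (simp flip: powr_add)
  hence 1: "u x powr (\<alpha> - 1) * laplacian u x = g x - u x powr (\<alpha> - 1) * f x"
    using pde[OF x] \<alpha>(3) by (simp add: right_diff_distrib flip: mult.assoc)
  have "w x powr (1 + 1 / \<gamma>) = u x powr (1 - \<alpha>)"
    unfolding w_def powr_powr \<alpha>(4) ..
  hence 2: "f x / w x powr (1 + 1 / \<gamma>) = u x powr (\<alpha> - 1) * f x"
    using powr_minus_divide[of "u x" "1 - \<alpha>"] by simp
  show ?thesis unfolding s1 2 s2 mult.assoc 1 by (simp add: algebra_simps)
qed

text \<open>Moving \<open>x1\<close> with speed \<open>a\<close> and \<open>x3\<close> with speed \<open>b\<close> along a coordinate direction moves the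
  intermediate point with speed \<open>t * a + (1 - t) * b\<close>. The claims are the first-order and second-order
  conditions for the gap along this motion.\<close>
lemma two_point_test:
  assumes x: "x1 \<in> \<Omega>" "x3 \<in> \<Omega>" and t: "0 \<le> t" "t \<le> 1"
    and min: "\<And>y1 y3. y1 \<in> \<Omega> \<Longrightarrow> y3 \<in> \<Omega> \<Longrightarrow> gap x1 x3 t \<le> gap y1 y3 t"
  defines "x2 \<equiv> t *\<^sub>R x1 + (1 - t) *\<^sub>R x3"
  shows "(t * a + (1 - t) * b) * dw i x2 = t * a * dw i x1 + (1 - t) * b * dw i x3"
    and "t * a\<^sup>2 * ddw i x1 + (1 - t) * b\<^sup>2 * ddw i x3 \<le> (t * a + (1 - t) * b)\<^sup>2 * ddw i x2"
proof -
  have x2: "x2 \<in> \<Omega>" unfolding x2_def using convexD[OF \<Omega>(4) x t(1), of "1 - t"] t by simp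
  let ?e = "axis i (1::real)" and ?k = "t * a + (1 - t) * b"
  let ?F = "\<lambda>s. (w (x2 + (?k * s) *\<^sub>R ?e) - t * w (x1 + (a * s) *\<^sub>R ?e)) - (1 - t) * w (x3 + (b * s) *\<^sub>R ?e)"
  have j: "jet2 ?F (?k * dw i x2 - t * (a * dw i x1) - (1 - t) * (b * dw i x3))
     (?k\<^sup>2 * ddw i x2 - t * (a\<^sup>2 * ddw i x1) - (1 - t) * (b\<^sup>2 * ddw i x3))"
    by (intro jet2_diff jet2_cmult jet2_scale[OF jet2_w] x x2)
  have F: "?F s = gap (x1 + (a * s) *\<^sub>R ?e) (x3 + (b * s) *\<^sub>R ?e) t" for s
  proof -
    have "t *\<^sub>R (x1 + (a * s) *\<^sub>R ?e) + (1 - t) *\<^sub>R (x3 + (b * s) *\<^sub>R ?e) = x2 + (?k * s) *\<^sub>R ?e"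
      unfolding x2_def by (simp add: algebra_simps)
    thus ?thesis unfolding gap_def by simp
  qed
  have ev: "\<forall>\<^sub>F s in nhds 0. y + (k * s) *\<^sub>R ?e \<in> \<Omega>" if "y \<in> \<Omega>" for y k
    using eventually_on_line[OF \<Omega>(1) that, of "k *\<^sub>R ?e"] by (simp add: mult.commute)
  have "\<forall>\<^sub>F s in nhds 0. ?F 0 \<le> ?F s"
    using ev[OF x(1), of a] ev[OF x(2), of b]
  proof eventually_elim
    case (elim s)
    show ?case unfolding F using min[OF elim] by simp
  qed
  from jet2_local_min[OF j this]
  show "?k * dw i x2 = t * a * dw i x1 + (1 - t) * b * dw i x3"
    "t * a\<^sup>2 * ddw i x1 + (1 - t) * b\<^sup>2 * ddw i x3 \<le> ?k\<^sup>2 * ddw i x2"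
    by (simp_all add: mult.assoc)
qed

text \<open>Summing the second-order conditions over all coordinate directions gives an inequality between
  Laplacians, into which the equation for \<open>w\<close> is inserted.\<close>
lemma interior_minimum_bound:
  assumes x: "x1 \<in> \<Omega>" "x3 \<in> \<Omega>" and t: "0 < t" "t < 1"
    and min: "\<And>y1 y3. y1 \<in> \<Omega> \<Longrightarrow> y3 \<in> \<Omega> \<Longrightarrow> gap x1 x3 t \<le> gap y1 y3 t"
  shows "- gap x1 x3 t \<le> m / (c * (1 + 1 / \<gamma>)) * \<delta>"
proof -
  define x2 where "x2 = t *\<^sub>R x1 + (1 - t) *\<^sub>R x3"
  have x2: "x2 \<in> \<Omega>" unfolding x2_def using convexD[OF \<Omega>(4) x, of t "1 - t"] t by simp
  note test = two_point_test[OF x less_imp_le[OF t(1)] less_imp_le[OF t(2)] min, folded x2_def]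
  \<comment> \<open>Moving only one of the two end points shows that all three gradients agree.\<close>
  have grad: "dw i x1 = dw i x2" "dw i x3 = dw i x2" for i
    using test(1)[of 1 0 i] test(1)[of 0 1 i] t by auto
  define A where "A = (1 - \<alpha>) / \<alpha>\<^sup>2 * (\<Sum>i\<in>UNIV. (dw i x2)\<^sup>2)"
  have A: "A \<ge> 0" unfolding A_def using \<alpha> by (intro mult_nonneg_nonneg sum_nonneg) auto
  define h where "h x = A / w x + f x / w x powr (1 + 1 / \<gamma>) - g x" for x
  have lap: "(\<Sum>i\<in>UNIV. ddw i x) = - \<alpha> * h x" if "x \<in> {x1, x2, x3}" for x
    using that equation_w[of x] x x2 grad unfolding h_def A_def by auto
  have "t * w x1 + (1 - t) * w x3 - w x2 \<le> m / (c * (1 + 1 / \<gamma>)) * \<delta>"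
  proof (rule concavity_defect_bound[where ?f1.0 = "f x1" and ?f2.0 = "f x2" and ?f3.0 = "f x3"
        and ?G1.0 = "g x1" and ?G2.0 = "g x2" and ?G3.0 = "g x3" and A = A])
    show "t * w x1 + (1 - t) * w x3 \<le> m powr (1 / (2 + 1 / \<gamma>))"
      using t w_le x by (intro convex_bound_le) auto
    show "f x2 powr (1 / (1 / \<gamma>)) \<ge> t * f x1 powr (1 / (1 / \<gamma>)) + (1 - t) * f x3 powr (1 / (1 / \<gamma>))"
      using f_conc x t unfolding concave_on_iff x2_def by auto
    show "g x2 - g x1 * g x3 / ((1 - t) * g x1 + t * g x3) \<le> \<delta>"
      using HC[OF x, of t] t by (simp add: harmonic_convexity_def x2_def)
    show "f x1 > 0" "f x3 > 0" "f x2 \<ge> c"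
      using f_ge x x2 pars(2) less_le_trans by blast+
    fix a b :: real assume ab: "t * a + (1 - t) * b = 1"
    have "(\<Sum>i\<in>UNIV. t * a\<^sup>2 * ddw i x1 + (1 - t) * b\<^sup>2 * ddw i x3) \<le> (\<Sum>i\<in>UNIV. ddw i x2)"
      using test(2)[where a = a and b = b] ab by (intro sum_mono) simp
    hence "t * a\<^sup>2 * (- \<alpha> * h x1) + (1 - t) * b\<^sup>2 * (- \<alpha> * h x3) \<le> - \<alpha> * h x2"
      using lap by (simp add: sum.distrib flip: sum_distrib_left)
    hence "\<alpha> * h x2 \<le> \<alpha> * (t * a\<^sup>2 * h x1 + (1 - t) * b\<^sup>2 * h x3)"
      by (simp add: algebra_simps)
    hence "h x2 \<le> t * a\<^sup>2 * h x1 + (1 - t) * b\<^sup>2 * h x3" using \<alpha>(1) by simp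
    thus "A / w x2 + f x2 / w x2 powr (1 + 1 / \<gamma>) - g x2
       \<le> t * a\<^sup>2 * (A / w x1 + f x1 / w x1 powr (1 + 1 / \<gamma>) - g x1) +
         (1 - t) * b\<^sup>2 * (A / w x3 + f x3 / w x3 powr (1 + 1 / \<gamma>) - g x3)"
      unfolding h_def .
  qed (use A t x x2 pars g w_pos m_pos in auto)
  thus ?thesis by (simp add: gap_def x2_def)
qed

text \<open>When \<open>x1\<close> is pushed inwards by \<open>s\<close>, the term \<open>t * w x1\<close> grows at least like \<open>s powr \<alpha>\<close>, whereas the
  value of \<open>w\<close> at the interior point \<open>x2\<close> changes only by a multiple of \<open>s\<close>.\<close>
lemma no_boundary_minimum:
  assumes x1: "x1 \<in> frontier \<Omega>" and t: "0 < t"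
    and x2: "t *\<^sub>R x1 + (1 - t) *\<^sub>R x3 \<in> \<Omega>"
    and min: "\<And>y. y \<in> closure \<Omega> \<Longrightarrow> gap x1 x3 t \<le> gap y x3 t"
  shows False
proof -
  let ?G = "\<lambda>x. u x powr (1 - \<alpha>) * g x"
  have "continuous_on (closure \<Omega>) ?G"
    using u_nonneg \<alpha>(2) by (intro continuous_intros continuous_on_powr' u g) auto
  moreover have "x1 \<in> closure \<Omega>" using x1 by (simp add: frontier_def)
  moreover have "c / 2 > 0" using pars by simp
  ultimately obtain e where e: "e > 0" "\<And>x. x \<in> closure \<Omega> \<Longrightarrow> dist x x1 < e \<Longrightarrow> dist (?G x) (?G x1) < c / 2"
    unfolding continuous_on_iff by metis
  have "?G x1 = 0" using u_zero[OF x1] by simp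
  hence lap: "laplacian u x < - (c / 2)" if "x \<in> \<Omega>" "dist x1 x < e" for x
    using e(2)[of x] pde[OF that(1)] f_ge[OF that(1)] that closure_subset[of \<Omega>] \<alpha>(3)
    by (auto simp: dist_commute dist_real_def abs_less_iff)
  obtain \<nu> \<tau> \<sigma> where \<nu>: "\<tau> > 0" "\<sigma> > 0"
    "\<forall>s\<in>{0..\<tau>}. x1 + s *\<^sub>R \<nu> \<in> closure \<Omega> \<and> \<sigma> * s \<le> u (x1 + s *\<^sub>R \<nu>)"
    by (rule linear_growth_at_boundary[OF \<Omega>(1) u(2) \<Omega>(5) x1 u(1) u_nonneg e(1) \<open>c / 2 > 0\<close> lap])
  define x2 where "x2 = t *\<^sub>R x1 + (1 - t) *\<^sub>R x3"
  let ?W = "\<lambda>s. w (x2 + s *\<^sub>R (t *\<^sub>R \<nu>))"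
  have "u differentiable (at (x2 + 0 *\<^sub>R (t *\<^sub>R \<nu>)))"
    using u(2) x2 unfolding C2_on_def C1_on_def x2_def by auto
  hence "(\<lambda>s. u (x2 + s *\<^sub>R (t *\<^sub>R \<nu>))) differentiable (at 0)"
    by (intro differentiable_compose[of u "\<lambda>s. x2 + s *\<^sub>R (t *\<^sub>R \<nu>)"]) auto
  then obtain D where "((\<lambda>s. u (x2 + s *\<^sub>R (t *\<^sub>R \<nu>))) has_real_derivative D) (at 0)"
    using real_differentiable_def by blast
  moreover have "u x2 > 0" using x2 u_pos by (simp add: x2_def)
  ultimately have "(?W has_real_derivative \<alpha> * u (x2 + 0 *\<^sub>R (t *\<^sub>R \<nu>)) powr (\<alpha> - 1) * D) (at 0)"
    unfolding w_def by (intro DERIV_chain2[OF has_real_derivative_powr]) auto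
  thus False
  proof (rule no_powr_growth_if_differentiable)
    show "t * \<sigma> powr \<alpha> > 0" "\<tau> > 0" "\<alpha> < 1" using t \<nu> \<alpha> by auto
    fix s :: real assume s: "0 < s" "s \<le> \<tau>"
    have y: "x1 + s *\<^sub>R \<nu> \<in> closure \<Omega>" "\<sigma> * s \<le> u (x1 + s *\<^sub>R \<nu>)" using \<nu>(3) s by auto
    have "\<sigma> powr \<alpha> * s powr \<alpha> = (\<sigma> * s) powr \<alpha>" using \<nu> s by (simp add: powr_mult)
    also have "\<dots> \<le> w (x1 + s *\<^sub>R \<nu>)" unfolding w_def using y(2) \<nu> s \<alpha> by (intro powr_mono2) auto
    finally have "t * (\<sigma> powr \<alpha> * s powr \<alpha>) \<le> t * w (x1 + s *\<^sub>R \<nu>)" using t by simp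
    moreover have "gap x1 x3 t \<le> gap (x1 + s *\<^sub>R \<nu>) x3 t" using min[OF y(1)] .
    moreover have "t *\<^sub>R (x1 + s *\<^sub>R \<nu>) + (1 - t) *\<^sub>R x3 = x2 + s *\<^sub>R (t *\<^sub>R \<nu>)"
      by (simp add: x2_def algebra_simps)
    ultimately show "?W 0 + t * \<sigma> powr \<alpha> * s powr \<alpha> \<le> ?W s"
      using w_frontier[OF x1] by (simp add: gap_def x2_def)
  qed
qed

lemma gap_commute: "gap x y t = gap y x (1 - t)"
  by (simp add: gap_def add.commute)

text \<open>The gap attains its minimum over the closed domain, and a negative minimum sits at interior end points,
  where the interior estimate applies. The boundary lemma covers both end points because the gap is
  symmetric under exchanging them.\<close>
lemma approximately_concave:
  assumes x: "x \<in> \<Omega>" "y \<in> \<Omega>" and s: "0 \<le> s" "s \<le> 1"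
  shows "s * w x + (1 - s) * w y \<le> w (s *\<^sub>R x + (1 - s) *\<^sub>R y) + m / (c * (1 + 1 / \<gamma>)) * \<delta>"
proof -
  let ?K = "m / (c * (1 + 1 / \<gamma>)) * \<delta>" and ?T = "closure \<Omega> \<times> closure \<Omega> \<times> {0..1::real}"
  have K: "?K \<ge> 0" using m_pos pars by simp
  have cc: "convex (closure \<Omega>)" using \<Omega>(4) by (rule convex_closure)
  have mid: "t *\<^sub>R a + (1 - t) *\<^sub>R b \<in> closure \<Omega>"
    if "a \<in> closure \<Omega>" "b \<in> closure \<Omega>" "0 \<le> t" "t \<le> 1" for a b t
    using convexD[OF cc that(1,2), of t "1 - t"] that by simp
  have comp: "compact ?T" using \<Omega>(3) by (intro compact_Times) (auto simp: compact_closure)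
  have ne: "?T \<noteq> {}" using \<Omega>(2) by auto
  have cont: "continuous_on ?T (\<lambda>(a, b, t). gap a b t)"
    unfolding gap_def split_beta
    by (intro continuous_intros continuous_on_compose2[OF continuous_w]) (auto intro: mid)
  obtain z where z: "z \<in> ?T" and zmin: "\<forall>z'\<in>?T. (\<lambda>(a, b, t). gap a b t) z \<le> (\<lambda>(a, b, t). gap a b t) z'"
    using continuous_attains_inf[OF comp ne cont] by (elim bexE)
  obtain x1 x3 t where zz: "z = (x1, x3, t)" by (cases z)
  have x13: "x1 \<in> closure \<Omega>" "x3 \<in> closure \<Omega>" and t: "0 \<le> t" "t \<le> 1" using z by (auto simp: zz)
  have min: "gap x1 x3 t \<le> gap a b t'"
    if "a \<in> closure \<Omega>" "b \<in> closure \<Omega>" "0 \<le> t'" "t' \<le> 1" for a b t'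
    using bspec[OF zmin, of "(a, b, t')"] that by (simp add: zz)
  have "- gap x1 x3 t \<le> ?K"
  proof (rule ccontr)
    assume "\<not> ?thesis"
    with K have neg: "gap x1 x3 t < 0" and big: "\<not> - gap x1 x3 t \<le> ?K" by auto
    have "t \<noteq> 0" "t \<noteq> 1" using neg by (auto simp: gap_def)
    with t have t: "0 < t" "t < 1" by auto
    have fr: "a \<in> frontier \<Omega>" if "a \<in> closure \<Omega>" "a \<notin> \<Omega>" for a
      using that \<Omega>(1) by (simp add: frontier_def interior_open)
    have sub: "\<And>a. a \<in> \<Omega> \<Longrightarrow> a \<in> closure \<Omega>" using closure_subset by auto
    have inner: "r *\<^sub>R a + (1 - r) *\<^sub>R b \<in> \<Omega>" if "a \<in> \<Omega>" "b \<in> closure \<Omega>" "0 < r" "r < 1" for a b r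
    proof -
      have "b - (1 - (1 - r)) *\<^sub>R (b - a) \<in> interior \<Omega>"
        using that \<Omega> by (intro mem_interior_closure_convex_shrink) (auto simp: interior_open)
      thus ?thesis using \<Omega>(1) by (simp add: interior_open algebra_simps)
    qed
    \<comment> \<open>If the intermediate point lies on the boundary, so do both end points, by convexity; then \<open>w\<close>
      vanishes at all three points.\<close>
    have x2: "t *\<^sub>R x1 + (1 - t) *\<^sub>R x3 \<in> \<Omega>"
    proof (rule ccontr)
      assume n: "\<not> ?thesis"
      hence "x1 \<notin> \<Omega>" "x3 \<notin> \<Omega>"
        using inner[of x1 x3 t] inner[of x3 x1 "1 - t"] x13 t by (auto simp: add.commute)
      hence "w x1 = 0" "w x3 = 0" using fr x13 w_frontier by auto
      with neg have "w (t *\<^sub>R x1 + (1 - t) *\<^sub>R x3) < 0" by (simp add: gap_def)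
      with w_nonneg show False by (simp add: leD)
    qed
    have x1: "x1 \<in> \<Omega>"
    proof (rule ccontr)
      assume "x1 \<notin> \<Omega>"
      from no_boundary_minimum[OF fr[OF x13(1) this] t(1) x2] min x13 t show False by auto
    qed
    have x3: "x3 \<in> \<Omega>"
    proof (rule ccontr)
      assume n: "x3 \<notin> \<Omega>"
      have "(1 - t) *\<^sub>R x3 + (1 - (1 - t)) *\<^sub>R x1 \<in> \<Omega>" using x2 by (simp add: add.commute)
      from no_boundary_minimum[OF fr[OF x13(2) n] _ this] min x13 t
      show False by (auto simp: gap_commute[of _ _ "1 - t"])
    qed
    have "- gap x1 x3 t \<le> ?K"
      using min sub t by (intro interior_minimum_bound x1 x3) auto
    with big show False by simp
  qed
  moreover have "gap x1 x3 t \<le> gap x y s" using x s closure_subset by (intro min) auto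
  ultimately show ?thesis by (simp add: gap_def)
qed

end

section \<open>Distance to the nearest concave function\<close>

theorem theorem4p4:
  fixes c m \<gamma> :: real
  assumes "CARD('n::finite) \<ge> 2" and "\<gamma> \<ge> 1" and "c > 0"
  shows "\<exists>C::real. \<forall>(\<Omega> :: (real ^ 'n) set) (f :: real ^ 'n \<Rightarrow> real) (g :: real ^ 'n \<Rightarrow> real)
           (u :: real ^ 'n \<Rightarrow> real) (\<delta> :: real).
      open \<Omega> \<and> connected \<Omega> \<and> \<Omega> \<noteq> {} \<and> bounded \<Omega> \<and> convex \<Omega> \<and> interior_ball_condition \<Omega> \<and>
      \<delta> \<ge> 0 \<and>
      continuous_on (closure \<Omega>) f \<and> (\<forall>x\<in>closure \<Omega>. f x > 0) \<and>
      continuous_on (closure \<Omega>) g \<and> (\<forall>x\<in>closure \<Omega>. g x > 0) \<and>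
      continuous_on (closure \<Omega>) u \<and> C2_on \<Omega> u \<and>
      (\<forall>x\<in>\<Omega>. laplacian u x + f x - u x powr ((1 + \<gamma>) / (1 + 2 * \<gamma>)) * g x = 0) \<and>
      (\<forall>x\<in>frontier \<Omega>. u x = 0) \<and>
      (\<forall>x\<in>\<Omega>. u x > 0) \<and>
      concave_on \<Omega> (\<lambda>x. f x powr \<gamma>) \<and>
      (\<forall>x\<in>\<Omega>. f x \<ge> c) \<and>
      Linf_norm \<Omega> u = ereal m \<and>
      (\<forall>x\<in>\<Omega>. f x \<ge> m powr ((1 + \<gamma>) / (1 + 2 * \<gamma>)) * g x) \<and>
      (\<forall>x1\<in>\<Omega>. \<forall>x3\<in>\<Omega>. \<forall>t\<in>{0..1}. harmonic_convexity g x1 x3 t \<le> \<delta>)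
      \<longrightarrow>
      (\<exists>v :: real ^ 'n \<Rightarrow> real. concave_on \<Omega> v \<and>
         Linf_norm \<Omega> (\<lambda>x. u x powr (\<gamma> / (1 + 2 * \<gamma>)) - v x) \<le> ereal (C * \<delta>))"
proof (intro exI[of _ "(CARD('n) + 2) * (m / (c * (1 + 1 / \<gamma>)))"] allI impI, elim conjE)
  fix \<Omega> :: "(real ^ 'n) set" and f g u :: "real ^ 'n \<Rightarrow> real" and \<delta> :: real
  assume \<Omega>: "open \<Omega>" "\<Omega> \<noteq> {}" "bounded \<Omega>" "convex \<Omega>" "interior_ball_condition \<Omega>" and \<delta>: "\<delta> \<ge> 0"
    and g: "continuous_on (closure \<Omega>) g" "\<forall>x\<in>closure \<Omega>. g x > 0"
    and u: "continuous_on (closure \<Omega>) u" "C2_on \<Omega> u"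
    and pde: "\<forall>x\<in>\<Omega>. laplacian u x + f x - u x powr ((1 + \<gamma>) / (1 + 2 * \<gamma>)) * g x = 0"
    and u0: "\<forall>x\<in>frontier \<Omega>. u x = 0" "\<forall>x\<in>\<Omega>. u x > 0"
    and f: "concave_on \<Omega> (\<lambda>x. f x powr \<gamma>)" "\<forall>x\<in>\<Omega>. f x \<ge> c"
    and m: "Linf_norm \<Omega> u = ereal m"
    and HC: "\<forall>x1\<in>\<Omega>. \<forall>x3\<in>\<Omega>. \<forall>t\<in>{0..1}. harmonic_convexity g x1 x3 t \<le> \<delta>"
  have sub: "\<Omega> \<subseteq> closure \<Omega>" by (rule closure_subset)
  interpret sublinear_dirichlet_problem \<Omega> f g u c m \<gamma> \<delta>
  proof
    show "u x \<le> m" if "x \<in> \<Omega>" for x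
      using le_Linf_norm_pointwise[OF \<Omega>(1) continuous_on_subset[OF u(1) sub] m that] .
    show "laplacian u x = u x powr ((1 + \<gamma>) / (1 + 2 * \<gamma>)) * g x - f x" if "x \<in> \<Omega>" for x
      using bspec[OF pde that] by simp
  qed (use \<Omega> \<delta> g u u0 f HC assms sub in auto)
  let ?K = "m / (c * (1 + 1 / \<gamma>)) * \<delta>"
  have K: "?K \<ge> 0" using m_pos pars by simp
  obtain v where v: "concave_on \<Omega> v"
    "\<forall>x\<in>\<Omega>. w x \<le> v x \<and> v x \<le> w x + (DIM(real ^ 'n) + 2) * ?K"
    by (rule hyers_ulam_concave[OF \<Omega>(4) K approximately_concave])
  have "continuous_on \<Omega> (\<lambda>x. - v x)"
    using v(1) \<Omega>(1) by (intro convex_on_continuous) (auto simp: concave_on_def)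
  hence "continuous_on \<Omega> v" using continuous_on_minus by fastforce
  hence "continuous_on \<Omega> (\<lambda>x. w x - v x)"
    using continuous_on_subset[OF continuous_w sub] by (intro continuous_intros)
  moreover have "\<bar>w x - v x\<bar> \<le> (CARD('n) + 2) * (m / (c * (1 + 1 / \<gamma>))) * \<delta>" if "x \<in> \<Omega>" for x
    using bspec[OF v(2) that] by (simp add: mult.assoc)
  ultimately have "Linf_norm \<Omega> (\<lambda>x. w x - v x) \<le> ereal ((CARD('n) + 2) * (m / (c * (1 + 1 / \<gamma>))) * \<delta>)"
    by (rule Linf_norm_leI[OF \<Omega>(1)])
  thus "\<exists>v. concave_on \<Omega> v \<and> Linf_norm \<Omega> (\<lambda>x. u x powr (\<gamma> / (1 + 2 * \<gamma>)) - v x)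
      \<le> ereal ((CARD('n) + 2) * (m / (c * (1 + 1 / \<gamma>))) * \<delta>)"
    using v(1) unfolding w_def \<alpha>_def by blast
qed

end
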